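(* Let $\Omega=[0,1]$ and let $u\in H^4(\Omega)\cap H^2_0(\Omega)$ satisfy $$\Big(\frac{d}{dx}\Big)^4u(x)=f(x).$$ If $f(x)\ge 0$ for $x\in\Omega$, then also $u(x)\ge 0$ for all $x\in\Omega$.
   Context: $H^2_0(\Omega)$ is the space of functions with first and second distributional derivatives in $L^2(\Omega)$ that vanish together with their first derivatives at the endpoints $0$ and $1$. Since $u\in H^4(\Omega)$, $f\in L^2(\Omega)$ and the inequality $f\ge0$ is understood almost everywhere. *)

theory Defs
  imports "HOL-Analysis.Analysis"
begin

abbreviation Omega :: "real set" where
  "Omega \<equiv> {0..1}"

text \<open>
  Functions on \<open>\<Omega> = [0,1]\<close> are represented by total functions \<open>real \<Rightarrow> real\<close>, whose values
  outside \<open>\<Omega>\<close> never matter. The spaces \<open>L2\<close> and \<open>H m\<close> consist of representatives rather than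
  of classes modulo almost-everywhere equality, and are closed under changes on null sets.
\<close>

definition L2 :: "(real \<Rightarrow> real) set" where
  "L2 = {u. u \<in> borel_measurable (lebesgue_on Omega) \<and>
            integrable (lebesgue_on Omega) (\<lambda>x. (u x)\<^sup>2)}"

definition test_function :: "(real \<Rightarrow> real) \<Rightarrow> bool" where
  "test_function \<phi> \<longleftrightarrow>
     (\<forall>k x. ((deriv ^^ k) \<phi>) differentiable (at x)) \<and>
     compact (closure {x. \<phi> x \<noteq> 0}) \<and> closure {x. \<phi> x \<noteq> 0} \<subseteq> interior Omega"

definition loc_integrable :: "(real \<Rightarrow> real) \<Rightarrow> bool" where
  "loc_integrable u \<longleftrightarrow>
     (\<forall>K. compact K \<and> K \<subseteq> interior Omega \<longrightarrow> integrable (lebesgue_on K) u)"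

text \<open>
  \<open>has_distr_deriv k u g\<close>: the \<open>k\<close>-th distributional derivative of \<open>u\<close> on the interior of
  \<open>\<Omega>\<close> is the function \<open>g\<close>. Local integrability makes all integrals below genuine, so that
  the convention that a non-integrable function has integral \<open>0\<close> plays no role.
\<close>

definition has_distr_deriv :: "nat \<Rightarrow> (real \<Rightarrow> real) \<Rightarrow> (real \<Rightarrow> real) \<Rightarrow> bool" where
  "has_distr_deriv k u g \<longleftrightarrow>
     loc_integrable u \<and> loc_integrable g \<and>
     (\<forall>\<phi>. test_function \<phi> \<longrightarrow>
        (LINT x|lebesgue_on Omega. u x * (deriv ^^ k) \<phi> x)
          = (-1) ^ k * (LINT x|lebesgue_on Omega. g x * \<phi> x))"

definition H :: "nat \<Rightarrow> (real \<Rightarrow> real) set" where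
  "H m = {u \<in> L2. \<forall>k\<in>{1..m}. \<exists>g\<in>L2. has_distr_deriv k u g}"

text \<open>
  Boundary values are those of the continuous representatives, which exist (uniquely) for
  a function in \<open>H 2\<close> and for its first distributional derivative by the Sobolev embedding in
  dimension one. A member \<open>u\<close> of \<open>H20\<close> is itself the continuous representative, so that its
  pointwise values are meaningful; \<open>v\<close> is the continuous representative of its derivative.
\<close>

definition H20 :: "(real \<Rightarrow> real) set" where
  "H20 = {u \<in> H 2. continuous_on Omega u \<and> u 0 = 0 \<and> u 1 = 0 \<and>
            (\<exists>v. continuous_on Omega v \<and> has_distr_deriv 1 u v \<and> v 0 = 0 \<and> v 1 = 0)}"

end

theory Submission imports Defs "HOL-Computational_Algebra.Polynomial" begin

text \<open>
  If \<open>u\<close> were four times differentiable, positivity would follow from a count of sign changes: a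
  clamped function that is negative somewhere has a derivative that is first negative and then
  positive inside the interval, hence a second derivative with signs \<open>-, +, -\<close>, hence a third
  derivative with signs \<open>+, -\<close>, hence a negative value of the fourth derivative. The argument
  survives if the boundary values and slopes only have the appropriate signs
  (\<open>nonneg_if_fourth_deriv_nonneg\<close>).

  The general case is reduced to this one by mollification. Let \<open>\<rho>\<close> be a smooth nonnegative bump
  of integral 1 supported in \<open>[-e, e]\<close>, let \<open>U = u * \<rho>\<close>, and let \<open>v\<close> be the continuous weak derivative
  of \<open>u\<close>, which vanishes at 0 and 1. For \<open>x\<close> at distance more than \<open>e\<close> from the
  endpoints, \<open>y \<mapsto> \<rho> (x - y)\<close> is a test function, so the distributional derivatives of \<open>u\<close> can be
  read off as \<open>U' = v * \<rho>\<close> and \<open>U'''' = f * \<rho> \<ge> 0\<close> (\<open>mollify_distr_deriv\<close>). At the points \<open>2e\<close> and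
  \<open>1 - 2e\<close> the values \<open>U\<close> and \<open>U'\<close> are averages of \<open>u\<close> and \<open>v\<close> near the boundary, where both are
  small by continuity, say at most \<open>\<eta>\<close> in modulus. Adding the quadratic barrier
  \<open>\<eta> + 2 \<eta> t (1 - t)\<close> gives these four boundary data the right signs without changing the fourth
  derivative, so \<open>U\<close> is bounded below by \<open>- 2 \<eta>\<close> between these two points
  (\<open>local_upper_bound_ge\<close>). Letting \<open>\<eta>\<close> and \<open>e\<close> tend to 0 yields \<open>u \<ge> 0\<close>.
\<close>

section \<open>Smooth functions\<close>

text \<open>
  The classical flat function \<open>exp (-1/x)\<close> for \<open>x > 0\<close>, extended by 0. The polynomial factor in \<open>1/x\<close>
  makes the family closed under differentiation, so that smoothness needs only one derivative.
\<close>

definition flat :: "real poly \<Rightarrow> real \<Rightarrow> real" where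
  "flat p x = (if x \<le> 0 then 0 else poly p (1/x) * exp (-1/x))"

lemma poly_times_exp_neg_tendsto_0:
  "((\<lambda>y::real. poly p y * exp (- y)) \<longlongrightarrow> 0) at_top"
proof -
  have "((\<lambda>y::real. \<Sum>i\<le>degree p. coeff p i * (y ^ i / exp y)) \<longlongrightarrow> (\<Sum>i\<le>degree p. coeff p i * 0)) at_top"
    by (intro tendsto_intros tendsto_power_div_exp_0)
  then show ?thesis
    by (simp add: poly_altdef sum_distrib_right exp_minus divide_inverse mult.assoc)
qed

text \<open>
  Only \<open>x = 0\<close> is delicate: the difference quotient from the right is \<open>y p(y) exp (-y)\<close> at
  \<open>y = 1/x\<close>, which vanishes at infinity because the exponential dominates every polynomial.
\<close>

lemma flat_has_derivative:
  "(flat p has_real_derivative flat ([:0,0,1:] * (p - pderiv p)) x) (at x)"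
proof -
  consider "x < 0" | "x > 0" | "x = 0" by linarith
  then show ?thesis
  proof cases
    case 1
    have "((\<lambda>x. 0) has_real_derivative 0) (at x)" by simp
    then have "(flat p has_real_derivative 0) (at x)"
      by (rule has_field_derivative_transform_within_open[where S = "{..<0}"])
         (use 1 in \<open>auto simp: flat_def\<close>)
    then show ?thesis using 1 by (simp add: flat_def)
  next
    case 2
    have "((\<lambda>x. poly p (1/x) * exp (-1/x)) has_real_derivative
             flat ([:0,0,1:] * (p - pderiv p)) x) (at x)"
      using 2 by (auto intro!: derivative_eq_intros DERIV_chain2[OF poly_DERIV]
          simp: flat_def field_simps power2_eq_square)
    then show ?thesis
      by (rule has_field_derivative_transform_within_open[where S = "{0<..}"])
         (use 2 in \<open>auto simp: flat_def\<close>)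
  next
    case 3
    have "((\<lambda>y. flat p y / y) \<longlongrightarrow> 0) (at_left 0)"
      by (rule tendsto_eventually) (auto simp: eventually_at_filter flat_def)
    moreover have "((\<lambda>y. flat p y / y) \<longlongrightarrow> 0) (at_right 0)"
    proof -
      have "((\<lambda>y. poly ([:0,1:] * p) (inverse y) * exp (- inverse y)) \<longlongrightarrow> 0) (at_right 0)"
        by (rule filterlim_compose[OF poly_times_exp_neg_tendsto_0 filterlim_inverse_at_top_right])
      then show ?thesis
        by (rule tendsto_cong[THEN iffD1, rotated])
           (auto simp: eventually_at_filter flat_def field_simps)
    qed
    ultimately have "((\<lambda>y. flat p y / y) \<longlongrightarrow> 0) (at 0)"
      by (simp add: filterlim_split_at)
    then show ?thesis using 3 by (simp add: has_field_derivative_iff flat_def)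
  qed
qed

definition smooth :: "(real \<Rightarrow> real) \<Rightarrow> bool" where
  "smooth f \<longleftrightarrow> (\<forall>k x. ((deriv ^^ k) f) differentiable (at x))"

lemma smooth_has_derivative: "smooth f \<Longrightarrow> ((deriv ^^ k) f has_real_derivative (deriv ^^ Suc k) f x) (at x)"
  by (simp add: smooth_def DERIV_deriv_iff_real_differentiable)

text \<open>
  Smoothness and all iterated derivatives are obtained by exhibiting a sequence \<open>D\<close> in which each
  function is the derivative of the previous one.
\<close>

lemma smooth_derivative_sequence:
  assumes "\<And>k x. (D k has_real_derivative D (Suc k) x) (at x)"
  shows "smooth (D 0)" "(deriv ^^ k) (D 0) = D k"
proof -
  have *: "(deriv ^^ k) (D 0) = D k" for k
    by (induction k) (auto intro!: ext DERIV_imp_deriv assms)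
  show "(deriv ^^ k) (D 0) = D k" by (rule *)
  show "smooth (D 0)" unfolding smooth_def *
    using assms real_differentiable_def by blast
qed

lemma smooth_flat: "smooth (flat p)"
  using smooth_derivative_sequence(1)[where D = "\<lambda>k. flat (((\<lambda>p. [:0,0,1:] * (p - pderiv p)) ^^ k) p)"]
    flat_has_derivative by simp

lemma smooth_affine:
  assumes "smooth f"
  shows "smooth (\<lambda>y. f (c * y + d))"
    and "(deriv ^^ k) (\<lambda>y. f (c * y + d)) = (\<lambda>y. c ^ k * (deriv ^^ k) f (c * y + d))"
proof -
  have "((\<lambda>y. c ^ k * (deriv ^^ k) f (c * y + d)) has_real_derivative
          c ^ Suc k * (deriv ^^ Suc k) f (c * x + d)) (at x)" for k x
    by (rule derivative_eq_intros DERIV_chain2[OF smooth_has_derivative[OF assms]] refl | simp)+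
  note smooth_derivative_sequence[where D = "\<lambda>k y. c ^ k * (deriv ^^ k) f (c * y + d)", OF this]
  then show "smooth (\<lambda>y. f (c * y + d))" 
   "(deriv ^^ k) (\<lambda>y. f (c * y + d)) = (\<lambda>y. c ^ k * (deriv ^^ k) f (c * y + d))"
    by simp_all
qed

text \<open>
  The sequence of derivatives is given by Leibniz' formula; passing from \<open>n\<close> to \<open>n + 1\<close> is Pascal's
  rule for the binomial coefficients.
\<close>

lemma smooth_mult:
  assumes "smooth f" "smooth g"
  shows "smooth (\<lambda>x. f x * g x)"
proof -
  define D where "D n = (\<lambda>x. \<Sum>k\<le>n. real (n choose k) * (deriv ^^ k) f x * (deriv ^^ (n - k)) g x)" for n
  have "(D n has_real_derivative D (Suc n) x) (at x)" for n x
  proof -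
    let ?f = "\<lambda>k. (deriv ^^ k) f x" and ?g = "\<lambda>k. (deriv ^^ k) g x"
    have "(D n has_real_derivative
        (\<Sum>k\<le>n. real (n choose k) * ?f (Suc k) * ?g (n - k) + real (n choose k) * ?f k * ?g (Suc (n - k)))) (at x)"
      unfolding D_def
      by (rule derivative_eq_intros smooth_has_derivative assms refl | simp add: algebra_simps)+
    also have "(\<Sum>k\<le>n. real (n choose k) * ?f (Suc k) * ?g (n - k) + real (n choose k) * ?f k * ?g (Suc (n - k)))
      = (\<Sum>k\<le>n. real (n choose k) * ?f (Suc k) * ?g (n - k))
      + (\<Sum>k\<le>Suc n. real (n choose k) * ?f k * ?g (Suc n - k))"
      by (simp add: sum.distrib Suc_diff_le del: funpow.simps)
    also have "\<dots> = D (Suc n) x"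
      unfolding D_def sum.atMost_Suc_shift
      by (simp add: sum.distrib[symmetric] algebra_simps del: funpow.simps sum.atMost_Suc)
    finally show ?thesis .
  qed
  then show ?thesis using smooth_derivative_sequence(1)[of D] by (simp add: D_def)
qed

section \<open>Positivity for the smooth problem\<close>

text \<open>
  A boundary value problem for a beam with signed data: the values at both ends and the inward
  slopes are nonnegative. Each application of the mean value theorem in the proof passes from an
  increase or decrease of one derivative to a sign of the next.
\<close>

lemma nonneg_if_fourth_deriv_nonneg:
  fixes W :: "nat \<Rightarrow> real \<Rightarrow> real"
  assumes der: "\<And>k x. k < 4 \<Longrightarrow> a \<le> x \<Longrightarrow> x \<le> b \<Longrightarrow> (W k has_real_derivative W (Suc k) x) (at x)"
    and nonneg: "\<And>x. a \<le> x \<Longrightarrow> x \<le> b \<Longrightarrow> W 4 x \<ge> 0"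
    and ends: "W 0 a \<ge> 0" "W 1 a \<ge> 0" "W 0 b \<ge> 0" "W 1 b \<le> 0"
    and x: "a \<le> x" "x \<le> b"
  shows "W 0 x \<ge> 0"
proof (rule ccontr)
  assume neg: "\<not> W 0 x \<ge> 0"
  have mvt: "\<exists>r. s < r \<and> r < t \<and> (t - s) * W (Suc k) r = W k t - W k s"
    if "k < 4" "a \<le> s" "s < t" "t \<le> b" for k s t
    using MVT2[of s t "W k" "W (Suc k)"] der that by force
  have up: "\<exists>r. s < r \<and> r < t \<and> W (Suc k) r > 0"
    if "W k s < W k t" "k < 4" "a \<le> s" "s < t" "t \<le> b" for k s t
    using mvt[of k s t] that by (smt (verit) mult_nonneg_nonpos)
  have down: "\<exists>r. s < r \<and> r < t \<and> W (Suc k) r < 0"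
    if "W k s > W k t" "k < 4" "a \<le> s" "s < t" "t \<le> b" for k s t
    using mvt[of k s t] that by (smt (verit) mult_nonneg_nonneg)
  have ax: "a < x" and xb: "x < b" using neg ends x by (auto simp: less_le)
  obtain p where p: "a < p" "p < x" "W (Suc 0) p < 0"
    using down[of 0 x a] ax xb neg ends by force
  obtain q where q: "x < q" "q < b" "W (Suc 0) q > 0"
    using up[of 0 x b] ax xb neg ends by force
  obtain s1 where s1: "a < s1" "s1 < p" "W (Suc (Suc 0)) s1 < 0"
    using down[of "Suc 0" p a] p q xb ends by force
  obtain s2 where s2: "p < s2" "s2 < q" "W (Suc (Suc 0)) s2 > 0"
    using up[of "Suc 0" p q] p q by force
  obtain s3 where s3: "q < s3" "s3 < b" "W (Suc (Suc 0)) s3 < 0"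
    using down[of "Suc 0" b q] p q ax ends by force
  obtain r1 where r1: "s1 < r1" "r1 < s2" "W (Suc (Suc (Suc 0))) r1 > 0"
    using up[of "Suc (Suc 0)" s1 s2] p q s1 s2 by force
  obtain r2 where r2: "s2 < r2" "r2 < s3" "W (Suc (Suc (Suc 0))) r2 < 0"
    using down[of "Suc (Suc 0)" s3 s2] p q s3 s2 by force
  obtain z where "r1 < z" "z < r2" "W (Suc (Suc (Suc (Suc 0)))) z < 0"
    using down[of "Suc (Suc (Suc 0))" r2 r1] p q s1 s2 s3 r1 r2 by force
  then show False using nonneg[of z] p q s1 s2 s3 r1 r2 by (simp add: numeral_eq_Suc)
qed

section \<open>Mollification\<close>

lemma smooth_continuous_on: "smooth f \<Longrightarrow> continuous_on S ((deriv ^^ k) f)"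
  by (meson DERIV_continuous_on has_field_derivative_at_within smooth_has_derivative)

text \<open>
  The bump is a product of two flat functions, one vanishing to the left of \<open>-e\<close> and the other to
  the right of \<open>e\<close>, scaled to have integral 1.
\<close>

lemma mollifier_exists:
  assumes "e > 0"
  shows "\<exists>\<rho>. smooth \<rho> \<and> (\<forall>z. \<rho> z \<ge> 0) \<and> (\<forall>z. \<bar>z\<bar> \<ge> e \<longrightarrow> \<rho> z = 0) \<and> (\<rho> has_integral 1) {-e..e}"
proof -
  \<comment> \<open>The scaling factor \<open>c\<close> is absorbed into the constant polynomial of one factor, so that
      scaled bumps are again products of flat functions.\<close>
  define \<beta> where "\<beta> c z = flat [:c:] (1 * z + e) * flat [:1:] (-1 * z + e)" for c z
  have smooth: "smooth (\<beta> c)" for c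
    unfolding \<beta>_def by (intro smooth_mult smooth_affine smooth_flat)
  have scale: "\<beta> c z = c * \<beta> 1 z" for c z by (simp add: \<beta>_def flat_def)
  have cont: "continuous_on {-e..e} (\<beta> 1)"
    using smooth_continuous_on[OF smooth, where k = 0] by simp
  have "integral (cbox (-e) e) (\<lambda>z. 0) < integral (cbox (-e) e) (\<beta> 1)"
    by (rule integral_less) (use assms cont in \<open>auto simp: \<beta>_def flat_def\<close>)
  then have pos: "integral {-e..e} (\<beta> 1) > 0" by simp
  define c where "c = inverse (integral {-e..e} (\<beta> 1))"
  have c: "c > 0" and c1: "c * integral {-e..e} (\<beta> 1) = 1" using pos by (auto simp: c_def)
  have "((\<lambda>z. c * \<beta> 1 z) has_integral c * integral {-e..e} (\<beta> 1)) {-e..e}"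
    by (intro has_integral_mult_right integrable_integral integrable_continuous_interval cont)
  then have "(\<beta> c has_integral 1) {-e..e}" by (simp only: c1 scale[symmetric])
  moreover have "\<beta> c z \<ge> 0" for z using c by (simp add: \<beta>_def flat_def)
  moreover have "\<beta> c z = 0" if "\<bar>z\<bar> \<ge> e" for z
    using that by (auto simp: \<beta>_def flat_def)
  ultimately show ?thesis using smooth by blast
qed

text \<open>
  Convolution of \<open>w\<close>, restricted to \<open>\<Omega>\<close>, with the kernel \<open>\<rho>\<close>. Differentiation falls on the kernel,
  which turns a merely continuous \<open>w\<close> into a smooth function.
\<close>

definition mollify :: "(real \<Rightarrow> real) \<Rightarrow> (real \<Rightarrow> real) \<Rightarrow> real \<Rightarrow> real" where
  "mollify \<rho> w x = integral Omega (\<lambda>y. w y * \<rho> (x - y))"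

lemma mollify_has_derivative:
  assumes w: "continuous_on Omega w" and \<rho>: "smooth \<rho>"
  shows "(mollify ((deriv ^^ k) \<rho>) w has_real_derivative mollify ((deriv ^^ Suc k) \<rho>) w x) (at x)"
proof -
  have "((\<lambda>x. integral (cbox 0 1) (\<lambda>y. w y * (deriv ^^ k) \<rho> (x - y))) has_real_derivative
      integral (cbox 0 1) (\<lambda>y. w y * (deriv ^^ Suc k) \<rho> (x - y))) (at x within UNIV)"
  proof (rule leibniz_rule_field_derivative)
    fix x y :: real
    show "((\<lambda>x. w y * (deriv ^^ k) \<rho> (x - y)) has_real_derivative w y * (deriv ^^ Suc k) \<rho> (x - y)) (at x within UNIV)"
      by (rule derivative_eq_intros DERIV_chain2[OF smooth_has_derivative[OF \<rho>]] refl | simp)+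
  next
    fix x :: real
    show "(\<lambda>y. w y * (deriv ^^ k) \<rho> (x - y)) integrable_on cbox 0 1"
      unfolding cbox_interval
      by (intro integrable_continuous_interval continuous_intros w
            continuous_on_compose2[OF smooth_continuous_on[OF \<rho>, of UNIV]]) auto
  next
    have "continuous_on (UNIV \<times> cbox 0 1) (\<lambda>p. w (snd p) * (deriv ^^ Suc k) \<rho> (fst p - snd p))"
      by (intro continuous_intros continuous_on_compose2[OF w]
            continuous_on_compose2[OF smooth_continuous_on[OF \<rho>, of UNIV]]) auto
    then show "continuous_on (UNIV \<times> cbox 0 1) (\<lambda>(x, y). w y * (deriv ^^ Suc k) \<rho> (x - y))"
      by (simp add: case_prod_beta)
  qed auto
  then show ?thesis by (simp add: mollify_def[abs_def])
qed

locale mollifier =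
  fixes \<rho> :: "real \<Rightarrow> real" and e :: real
  assumes smooth: "smooth \<rho>"
    and nonneg: "\<rho> z \<ge> 0"
    and support: "\<bar>z\<bar> \<ge> e \<Longrightarrow> \<rho> z = 0"
    and integral_1: "(\<rho> has_integral 1) {-e..e}"
begin

lemma translate_has_integral:
  assumes "e \<le> x" "x \<le> 1 - e"
  shows "((\<lambda>y. \<rho> (x - y)) has_integral 1) Omega"
proof -
  have "((\<lambda>y. \<rho> (-1 *\<^sub>R y + x)) has_integral (1 / \<bar>-1\<bar> ^ DIM(real)) *\<^sub>R 1)
        ((\<lambda>y. (1 / -1) *\<^sub>R y + - ((1 / -1) *\<^sub>R x)) ` cbox (-e) e)"
    by (rule has_integral_affinity) (use integral_1 in auto)
  moreover have "(\<lambda>y. (1 / -1) *\<^sub>R y + - ((1 / -1) *\<^sub>R x)) ` cbox (-e) e = {x-e..x+e}"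
    by (auto simp: image_iff intro!: bexI[of _ "x - _"])
  ultimately have "((\<lambda>y. \<rho> (x - y)) has_integral 1) {x-e..x+e}" by simp
  then show ?thesis
    by (rule has_integral_on_superset) (use assms in \<open>auto intro!: support\<close>)
qed

text \<open>
  Within \<open>\<Omega>\<close> and away from its boundary a mollified function is a weighted average over a ball of
  radius \<open>e\<close>, and so obeys every bound that holds on that ball.
\<close>

lemma mollify_le:
  assumes w: "continuous_on Omega w" and x: "e \<le> x" "x \<le> 1 - e"
    and le: "\<And>y. \<bar>x - y\<bar> < e \<Longrightarrow> w y \<le> c"
  shows "mollify \<rho> w x \<le> c"
proof -
  have *: "((\<lambda>y. c * \<rho> (x - y)) has_integral c * 1) Omega"
    by (intro has_integral_mult_right translate_has_integral x)
  have "((\<lambda>y. w y * \<rho> (x - y)) has_integral mollify \<rho> w x) Omega"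
    unfolding mollify_def
    by (intro integrable_integral integrable_continuous_interval continuous_intros w
        continuous_on_compose2[OF smooth_continuous_on[OF smooth, of UNIV 0, simplified]]) auto
  then have "mollify \<rho> w x \<le> c * 1"
  proof (rule has_integral_le[OF _ *])
    fix y
    show "w y * \<rho> (x - y) \<le> c * \<rho> (x - y)"
    proof (cases "\<bar>x - y\<bar> < e")
      case True
      then show ?thesis by (intro mult_right_mono le nonneg)
    next
      case False
      then show ?thesis using support[of "x - y"] by simp
    qed
  qed
  then show ?thesis by simp
qed

lemma mollify_ge:
  assumes w: "continuous_on Omega w" and x: "e \<le> x" "x \<le> 1 - e"
    and ge: "\<And>y. \<bar>x - y\<bar> < e \<Longrightarrow> w y \<ge> c"
  shows "mollify \<rho> w x \<ge> c"
proof -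
  have "mollify \<rho> (\<lambda>y. - w y) x \<le> - c"
    by (rule mollify_le) (use assms in \<open>auto intro: continuous_on_minus\<close>)
  then show ?thesis by (simp add: mollify_def)
qed

lemma test_function_translate:
  assumes "e < x" "x < 1 - e"
  shows "test_function (\<lambda>y. \<rho> (x - y))"
proof -
  have "{y. \<rho> (x - y) \<noteq> 0} \<subseteq> {x-e..x+e}"
  proof
    fix y assume "y \<in> {y. \<rho> (x - y) \<noteq> 0}"
    then have "\<not> \<bar>x - y\<bar> \<ge> e" using support[of "x - y"] by auto
    then show "y \<in> {x-e..x+e}" by auto
  qed
  then have sub: "closure {y. \<rho> (x - y) \<noteq> 0} \<subseteq> {x-e..x+e}"
    by (rule closure_minimal) simp
  then have "compact (closure {y. \<rho> (x - y) \<noteq> 0})"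
    by (meson bounded_closed_interval bounded_subset closed_closure compact_eq_bounded_closed)
  moreover have "closure {y. \<rho> (x - y) \<noteq> 0} \<subseteq> interior Omega"
    using sub assms by (force simp: interior_atLeastAtMost_real)
  moreover have "smooth (\<lambda>y. \<rho> (-1 * y + x))" by (rule smooth_affine[OF smooth])
  ultimately show ?thesis by (simp add: test_function_def smooth_def)
qed

text \<open>
  The definition of the distributional derivative, tested with the translated and reflected kernel:
  the reflection contributes a factor \<open>(-1)^k\<close> that cancels the one in the definition.
\<close>

lemma mollify_distr_deriv:
  assumes u: "continuous_on Omega u" and g: "has_distr_deriv k u g" and x: "e < x" "x < 1 - e"
  shows "mollify ((deriv ^^ k) \<rho>) u x = (LINT y|lebesgue_on Omega. g y * \<rho> (x - y))"
proof -
  have "(deriv ^^ k) (\<lambda>y. \<rho> (x - y)) = (\<lambda>y. (-1) ^ k * (deriv ^^ k) \<rho> (x - y))"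
    using smooth_affine(2)[OF smooth, of k "-1" x] by simp
  moreover have "(LINT y|lebesgue_on Omega. u y * (deriv ^^ k) (\<lambda>y. \<rho> (x - y)) y)
      = (-1) ^ k * (LINT y|lebesgue_on Omega. g y * \<rho> (x - y))"
    using g test_function_translate[OF x] unfolding has_distr_deriv_def by blast
  ultimately have "(LINT y|lebesgue_on Omega. u y * ((-1) ^ k * (deriv ^^ k) \<rho> (x - y)))
      = (-1) ^ k * (LINT y|lebesgue_on Omega. g y * \<rho> (x - y))"
    by simp
  moreover have "(LINT y|lebesgue_on Omega. u y * ((-1) ^ k * (deriv ^^ k) \<rho> (x - y)))
      = (-1) ^ k * (LINT y|lebesgue_on Omega. u y * (deriv ^^ k) \<rho> (x - y))"
    by (subst integral_mult_right_zero[symmetric]) (simp add: mult_ac)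
  moreover have "(LINT y|lebesgue_on Omega. u y * (deriv ^^ k) \<rho> (x - y))
      = mollify ((deriv ^^ k) \<rho>) u x"
    unfolding mollify_def
    by (intro lebesgue_integral_eq_integral continuous_imp_integrable_real continuous_intros u
        continuous_on_compose2[OF smooth_continuous_on[OF smooth, of UNIV]]) auto
  ultimately show ?thesis by simp
qed

end

section \<open>Positivity of the weak solution\<close>

text \<open>
  The quantitative form of the theorem at scale \<open>e\<close>. The point values of \<open>u\<close> near \<open>x\<close> enter through
  an upper bound \<open>c\<close> because the argument only controls the average \<open>U x\<close> of \<open>u\<close> around \<open>x\<close>.
\<close>

lemma local_upper_bound_ge:
  assumes u: "continuous_on Omega u" and v: "continuous_on Omega v"
    and uv: "has_distr_deriv 1 u v" and uf: "has_distr_deriv 4 u f"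
    and f: "AE x in lebesgue_on Omega. f x \<ge> 0"
    and e: "0 < e" "e \<le> 1/8" and \<eta>: "\<eta> > 0"
    and near0: "\<And>y. 0 < y \<Longrightarrow> y < 3 * e \<Longrightarrow> \<bar>u y\<bar> \<le> \<eta> \<and> \<bar>v y\<bar> \<le> \<eta>"
    and near1: "\<And>y. 1 - 3 * e < y \<Longrightarrow> y < 1 \<Longrightarrow> \<bar>u y\<bar> \<le> \<eta> \<and> \<bar>v y\<bar> \<le> \<eta>"
    and x: "2 * e \<le> x" "x \<le> 1 - 2 * e"
    and nearx: "\<And>y. \<bar>x - y\<bar> < e \<Longrightarrow> u y \<le> c"
  shows "c \<ge> - 2 * \<eta>"
proof -
  obtain \<rho> where \<rho>: "smooth \<rho>" "\<And>z. \<rho> z \<ge> 0" "\<And>z. \<bar>z\<bar> \<ge> e \<Longrightarrow> \<rho> z = 0" "(\<rho> has_integral 1) {-e..e}"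
    using mollifier_exists[OF e(1)] by blast
  interpret mollifier \<rho> e by standard (use \<rho> in auto)
  define U where "U k = mollify ((deriv ^^ k) \<rho>) u" for k
  have dU: "(U k has_real_derivative U (Suc k) t) (at t)" for k t
    unfolding U_def by (rule mollify_has_derivative[OF u smooth])
  have U1: "U 1 t = mollify \<rho> v t" if "2 * e \<le> t" "t \<le> 1 - 2 * e" for t
  proof -
    have "U 1 t = (LINT y|lebesgue_on Omega. v y * \<rho> (t - y))"
      unfolding U_def by (rule mollify_distr_deriv[OF u uv]) (use that e in auto)
    also have "\<dots> = mollify \<rho> v t"
      unfolding mollify_def
      by (intro lebesgue_integral_eq_integral continuous_imp_integrable_real continuous_intros v
        continuous_on_compose2[OF smooth_continuous_on[OF smooth, of UNIV 0, simplified]]) auto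
    finally show ?thesis .
  qed
  have U4: "U 4 t \<ge> 0" if "2 * e \<le> t" "t \<le> 1 - 2 * e" for t
  proof -
    have "U 4 t = (LINT y|lebesgue_on Omega. f y * \<rho> (t - y))"
      unfolding U_def by (rule mollify_distr_deriv[OF u uf]) (use that e in auto)
    also have "\<dots> \<ge> 0"
      using f by (intro integral_nonneg_AE) (auto elim!: eventually_mono intro: mult_nonneg_nonneg nonneg)
    finally show ?thesis .
  qed
  \<comment> \<open>The list of derivatives of \<open>U t + \<eta> + 2 \<eta> t (1 - t)\<close>. The constant makes up for the boundary
      values; the quadratic has inward slope \<open>2 \<eta> (1 - 4 e) \<ge> \<eta>\<close> at \<open>2 e\<close> and \<open>1 - 2 e\<close>, as
      \<open>e \<le> 1/8\<close>, which makes up for the boundary slopes.\<close>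
  define W where "W k t = U k t + (if k = 0 then \<eta> + 2 * \<eta> * t * (1 - t)
      else if k = 1 then 2 * \<eta> * (1 - 2 * t) else if k = 2 then - 4 * \<eta> else 0)" for k :: nat and t
  have "W 0 x \<ge> 0"
  proof (rule nonneg_if_fourth_deriv_nonneg[where W = W and a = "2 * e" and b = "1 - 2 * e"])
    fix k :: nat and t :: real assume "k < 4"
    then consider "k = 0" | "k = 1" | "k = 2" | "k = 3" by linarith
    then show "(W k has_real_derivative W (Suc k) t) (at t)"
      using dU[of 3 t]
      by cases (auto simp: W_def[abs_def] algebra_simps simp del: mult_minus_left intro!: derivative_eq_intros dU)
  next
    fix t assume "2 * e \<le> t" "t \<le> 1 - 2 * e"
    then show "W 4 t \<ge> 0" using U4 by (simp add: W_def)
  next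
    have U0: "U 0 = mollify \<rho> u" by (simp add: U_def)
    have near0': "- \<eta> \<le> u y" "- \<eta> \<le> v y" if "\<bar>2 * e - y\<bar> < e" for y
      using near0[of y] that by linarith+
    have near1': "- \<eta> \<le> u y" "v y \<le> \<eta>" if "\<bar>1 - 2 * e - y\<bar> < e" for y
      using near1[of y] that by linarith+
    have inside: "e \<le> 2 * e" "2 * e \<le> 1 - e" "e \<le> 1 - 2 * e" "1 - 2 * e \<le> 1 - e" "2 * e \<le> 1 - 2 * e"
      using e by auto
    have "U 0 (2 * e) \<ge> - \<eta>" "U 0 (1 - 2 * e) \<ge> - \<eta>"
      unfolding U0 by (rule mollify_ge[OF u]; fact inside near0' near1')+
    moreover have "\<eta> * (2 * (2 * e) * (1 - 2 * e)) \<ge> 0"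
      using e \<eta> by simp
    ultimately show "W 0 (2 * e) \<ge> 0" "W 0 (1 - 2 * e) \<ge> 0"
      by (simp_all add: W_def mult_ac)
    have "U 1 (2 * e) \<ge> - \<eta>" "U 1 (1 - 2 * e) \<le> \<eta>"
      using U1 mollify_ge[OF v inside(1,2) near0'(2)] mollify_le[OF v inside(3,4) near1'(2)] inside(5)
      by simp_all
    moreover have "\<eta> * 1 \<le> \<eta> * (2 * (1 - 2 * (2 * e)))"
      using e \<eta> by (intro mult_left_mono) auto
    ultimately show "W 1 (2 * e) \<ge> 0" "W 1 (1 - 2 * e) \<le> 0"
      by (simp_all add: W_def algebra_simps)
  qed (use x in auto)
  moreover have "U 0 x \<le> c"
  proof -
    have "mollify \<rho> u x \<le> c" by (rule mollify_le[OF u _ _ nearx]) (use x e in auto)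
    then show ?thesis by (simp add: U_def)
  qed
  moreover have "2 * \<eta> * x * (1 - x) \<le> \<eta>"
  proof -
    have "x\<^sup>2 + (1 - x)\<^sup>2 \<ge> 0" by simp
    then have "2 * x * (1 - x) \<le> 1" by (simp add: power2_eq_square algebra_simps)
    then have "\<eta> * (2 * x * (1 - x)) \<le> \<eta> * 1" using \<eta> by (intro mult_left_mono) auto
    then show ?thesis by (simp add: mult_ac)
  qed
  ultimately show ?thesis by (simp add: W_def)
qed

theorem proposition5p1:
  fixes u f :: "real \<Rightarrow> real"
  assumes "u \<in> H 4 \<inter> H20"
    and "has_distr_deriv 4 u f"
    and "AE x in lebesgue_on Omega. f x \<ge> 0"
  shows "\<forall>x\<in>Omega. u x \<ge> 0"
proof
  fix x assume "x \<in> Omega"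
  obtain v where u: "continuous_on Omega u" "u 0 = 0" "u 1 = 0"
    and v: "continuous_on Omega v" "has_distr_deriv 1 u v" "v 0 = 0" "v 1 = 0"
    using assms(1) by (auto simp: H20_def)
  have near: "\<exists>d>0. \<forall>y\<in>Omega. \<bar>y - s\<bar> < d \<longrightarrow> \<bar>w y - w s\<bar> < \<eta>"
    if "continuous_on Omega w" "s \<in> Omega" "\<eta> > 0" for w :: "real \<Rightarrow> real" and s \<eta>
    using that unfolding continuous_on_iff dist_real_def by blast
  show "u x \<ge> 0"
  proof (cases "x = 0 \<or> x = 1")
    case True then show ?thesis using u by auto
  next
    case False
    then have x: "0 < x" "x < 1" using \<open>x \<in> Omega\<close> by auto
    have "- (u x) \<le> 3 * \<eta>" if \<eta>: "\<eta> > 0" for \<eta>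
    proof -
      obtain d1 where d1: "d1 > 0" "\<And>y. y \<in> Omega \<Longrightarrow> \<bar>y - 0\<bar> < d1 \<Longrightarrow> \<bar>u y - u 0\<bar> < \<eta>"
        using near[OF u(1) _ \<eta>, of 0] by auto
      obtain d2 where d2: "d2 > 0" "\<And>y. y \<in> Omega \<Longrightarrow> \<bar>y - 1\<bar> < d2 \<Longrightarrow> \<bar>u y - u 1\<bar> < \<eta>"
        using near[OF u(1) _ \<eta>, of 1] by auto
      obtain d3 where d3: "d3 > 0" "\<And>y. y \<in> Omega \<Longrightarrow> \<bar>y - 0\<bar> < d3 \<Longrightarrow> \<bar>v y - v 0\<bar> < \<eta>"
        using near[OF v(1) _ \<eta>, of 0] by auto
      obtain d4 where d4: "d4 > 0" "\<And>y. y \<in> Omega \<Longrightarrow> \<bar>y - 1\<bar> < d4 \<Longrightarrow> \<bar>v y - v 1\<bar> < \<eta>"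
        using near[OF v(1) _ \<eta>, of 1] by auto
      obtain d5 where d5: "d5 > 0" "\<And>y. y \<in> Omega \<Longrightarrow> \<bar>y - x\<bar> < d5 \<Longrightarrow> \<bar>u y - u x\<bar> < \<eta>"
        using near[OF u(1) \<open>x \<in> Omega\<close> \<eta>] by auto
      \<comment> \<open>The scale is small enough for all five continuity estimates, for \<open>x\<close> to lie in
          \<open>[2e, 1 - 2e]\<close>, and for \<open>e \<le> 1/8\<close>.\<close>
      define S where "S = {d1, d2, d3, d4, d5, x, 1 - x, 3/8}"
      define e where "e = Min S / 3"
      have S: "finite S" "S \<noteq> {}" "\<forall>d\<in>S. d > 0"
        using d1(1) d2(1) d3(1) d4(1) d5(1) x by (simp_all add: S_def)
      then have "e > 0" by (simp add: e_def)
      have e_le: "3 * e \<le> d" if "d \<in> S" for d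
        using that S(1) by (simp add: e_def)
      have e: "3 * e \<le> d1" "3 * e \<le> d2" "3 * e \<le> d3" "3 * e \<le> d4" "3 * e \<le> d5"
        "3 * e \<le> x" "3 * e \<le> 1 - x" "3 * e \<le> 3/8"
        by (rule e_le, simp add: S_def)+
      have "u x + \<eta> \<ge> - 2 * \<eta>"
      proof (rule local_upper_bound_ge[OF u(1) v(1,2) assms(2,3) \<open>e > 0\<close> _ \<eta>, where x = x])
        fix y assume y: "0 < y" "y < 3 * e"
        then have "\<bar>u y - u 0\<bar> < \<eta>" "\<bar>v y - v 0\<bar> < \<eta>"
          using e by (auto intro!: d1(2) d3(2))
        then show "\<bar>u y\<bar> \<le> \<eta> \<and> \<bar>v y\<bar> \<le> \<eta>" using u v by simp
      next
        fix y assume y: "1 - 3 * e < y" "y < 1"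
        then have "\<bar>u y - u 1\<bar> < \<eta>" "\<bar>v y - v 1\<bar> < \<eta>"
          using e by (auto intro!: d2(2) d4(2))
        then show "\<bar>u y\<bar> \<le> \<eta> \<and> \<bar>v y\<bar> \<le> \<eta>" using u v by simp
      next
        fix y assume y: "\<bar>x - y\<bar> < e"
        then have "\<bar>u y - u x\<bar> < \<eta>"
          using e \<open>e > 0\<close> by (intro d5(2)) auto
        then show "u y \<le> u x + \<eta>" by linarith
      qed (use e \<open>e > 0\<close> in auto)
      then show ?thesis by simp
    qed
    \<comment> \<open>If \<open>u x < 0\<close>, this \<open>\<eta>\<close> would give \<open>- (u x) \<le> - (u x) / 2\<close>.\<close>
    from this[of "- (u x) / 6"] show ?thesis by (cases "u x \<ge> 0") auto
  qed
qed

end
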